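(* Consider a distributed random convex program over a strongly connected directed graph $\mathcal{G}$ with local constraint sets $C_1,\dots,C_n$, and let all nodes run the active constraints consensus (ACC) algorithm, both as described in the context. Then: (i) for each node $i$, the local optimal objective $J_i^*(t)$ is monotonically non-decreasing in the iterations $t$; (ii) there is a finite number $T$ of iterations after which the local optimal objective and the local solution of each node have converged to the optimal value and the scenario solution of the global problem: $J_i^*(T)=J^*(C)$ and $x_i^*(T)=x^*(C)$ for every node $i$; (iii) for each node $i$, the local candidate set $A_i(T)$ coincides with the active set $\mathrm{Ac}(C)$ of the global problem; (iv) if the constraints in $C$ are in general position, then at each iteration of the algorithm each node transmits to each of its outgoing neighbors its current objective value $J_i^*(t)$ and at most $d$ constraints (i.e. $|A_i(t)|\le d$).
   Context: Problem. Let $X\subset\mathbb{R}^d$ be compact and convex, $a\in\mathbb{R}^d$, $\Delta\subseteq\mathbb{R}^\ell$, and $f:\mathbb{R}^d\times\Delta\to\mathbb{R}$ with $f(\cdot,\delta)$ convex for every $\delta\in\Delta$. Let $\delta^{(1)},\dots,\delta^{(N)}\in\Delta$ be a given realization of $N$ i.i.d. samples of a random parameter, $C=\{1,\dots,N\}$ and $f_j(x)=f(x,\delta^{(j)})$. For $S\subseteq C$, $P[S]$ is the problem: minimize $a^\top x$ over $x\in X$ subject to $f_j(x)\le 0$ for all $j\in S$; its optimal solution and value are $x^*(S)$ and $J^*(S)$, with $x^*(S)=\mathrm{NaN}$ and $J^*(S)=\infty$ if $P[S]$ is infeasible. $P[C]$ is an instance of a random convex program (RCP), and $x^*(C)$ is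 called the scenario solution. Standing assumption (unique minimum condition): every feasible $P[S]$, $S\subseteq C$, has a unique optimal solution. Active set: if $P[S]$ is feasible, $\mathrm{Ac}(S)=\{j\in S: f_j(x^*(S))=0\}$; if $P[S]$ is infeasible, $\mathrm{Ac}(S)=\emptyset$. General position: the constraints in $C$ are in general position if $|\{j\in C: f_j(x)=0\}|\le d$ for all $x\in X$. Network. $\mathcal{G}$ is a strongly connected directed graph on nodes $\{1,\dots,n\}$; an edge $(i,j)$ means $i$ can transmit to $j$. $\mathcal{N}_{\rm in}(i)$ and $\mathcal{N}_{\rm out}(i)$ are the in- and out-neighbors of $i$. $\mathrm{diam}(\mathcal{G})$ is the diameter (maximum over ordered pairs of nodes of the length of a shortest directed path). Node $i$ knows $a$, $\mathrm{diam}(\mathcal G)$ and a subset $C_i\subset C$ of the constraints, with $\bigcup_{i=1}^n C_i=C$. ACC algorithm (synchronous, run by each node $i$). Initialization: $A_i(0)=\mathrm{Ac}(C_i)$, $J_i^*(0)=J^*(C_i)$, $x_i^*(0)=x^*(C_i)$, counter $\mathrm{ncg}=1$, $t=0$. While $\mathrm{ncg}<2\,\mathrm{diam}(\mathcal{G})+1$ and $J_i^*(t)<\infty$: receive $A_j(t)$, $J_j^*(t)$ from all $j\in\mathcal{N}_{\rm in}(i)$; set $L_i(t+1)=A_i(t)\cup\big(\bigcup_{j\in\mathcal{N}_{\rm in}(i)}A_j(t)\big)\cup C_i$ and $\bar J_i^*(t+1)=\max_{j\in\mathcal{N}_{\rm in}(i)}J_j^*(t)$. If $\bar J_i^*(t+1)=\infty$,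 set $A_i(t+1)=\emptyset$, $J_i^*(t+1)=\infty$, $x_i^*(t+1)=\mathrm{NaN}$ and exit. Otherwise set $A_i(t+1)=\mathrm{Ac}(L_i(t+1))$, $J_i^*(t+1)=J^*(L_i(t+1))$, $x_i^*(t+1)=x^*(L_i(t+1))$; if $J_i^*(t+1)=J_i^*(t)$ increase $\mathrm{ncg}$ by one, else reset $\mathrm{ncg}=1$; then increase $t$ by one. The output is the final $x_i^*,J_i^*,A_i$. A node that has stopped keeps its final values, which remain available to its out-neighbors. The information transmitted by node $i$ at iteration $t$ is $J_i^*(t)$ and the constraints in $A_i(t)$. *)

theory Defs
  imports
    "HOL-Analysis.Analysis"
    "Graph_Theory.Digraph_Component"
begin

section \<open>Convex programs with indexed constraints\<close>

text \<open>
  A set of constraints is a set of indices \<open>j\<close>; \<open>g j\<close> is the \<open>j\<close>-th constraint function.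
  The value \<open>None\<close> plays the role of NaN.
\<close>

definition sampled_constr ::
    "('x \<Rightarrow> 'p \<Rightarrow> real) \<Rightarrow> (nat \<Rightarrow> 'p) \<Rightarrow> nat \<Rightarrow> 'x \<Rightarrow> real" where
  "sampled_constr f \<delta> j x = f x (\<delta> j)"

definition feasible_points ::
    "(real^'d) set \<Rightarrow> (nat \<Rightarrow> real^'d \<Rightarrow> real) \<Rightarrow> nat set \<Rightarrow> (real^'d) set" where
  "feasible_points X g S = {x \<in> X. \<forall>j\<in>S. g j x \<le> 0}"

definition optimal_solution ::
    "(real^'d) set \<Rightarrow> real^'d \<Rightarrow> (nat \<Rightarrow> real^'d \<Rightarrow> real) \<Rightarrow> nat set \<Rightarrow> real^'d \<Rightarrow> bool" where
  "optimal_solution X a g S x \<longleftrightarrow>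
     is_arg_min (\<lambda>y. a \<bullet> y) (\<lambda>y. y \<in> feasible_points X g S) x"

definition unique_minimum_condition ::
    "(real^'d) set \<Rightarrow> real^'d \<Rightarrow> (nat \<Rightarrow> real^'d \<Rightarrow> real) \<Rightarrow> nat set \<Rightarrow> bool" where
  "unique_minimum_condition X a g C \<longleftrightarrow>
     (\<forall>S\<subseteq>C. feasible_points X g S \<noteq> {} \<longrightarrow> (\<exists>!x. optimal_solution X a g S x))"

definition x_opt ::
    "(real^'d) set \<Rightarrow> real^'d \<Rightarrow> (nat \<Rightarrow> real^'d \<Rightarrow> real) \<Rightarrow> nat set \<Rightarrow> (real^'d) option" where
  "x_opt X a g S =
     (if feasible_points X g S = {} then None else Some (THE x. optimal_solution X a g S x))"

definition J_opt ::
    "(real^'d) set \<Rightarrow> real^'d \<Rightarrow> (nat \<Rightarrow> real^'d \<Rightarrow> real) \<Rightarrow> nat set \<Rightarrow> ereal" where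
  "J_opt X a g S = (case x_opt X a g S of None \<Rightarrow> \<infinity> | Some x \<Rightarrow> ereal (a \<bullet> x))"

definition active_set ::
    "(real^'d) set \<Rightarrow> real^'d \<Rightarrow> (nat \<Rightarrow> real^'d \<Rightarrow> real) \<Rightarrow> nat set \<Rightarrow> nat set" where
  "active_set X a g S =
     (case x_opt X a g S of None \<Rightarrow> {} | Some x \<Rightarrow> {j \<in> S. g j x = 0})"

definition general_position ::
    "(real^'d) set \<Rightarrow> (nat \<Rightarrow> real^'d \<Rightarrow> real) \<Rightarrow> nat set \<Rightarrow> bool" where
  "general_position X g C \<longleftrightarrow> (\<forall>x\<in>X. card {j \<in> C. g j x = 0} \<le> CARD('d))"


section \<open>Directed networks\<close>

definition in_neighbors :: "'v pair_pre_digraph \<Rightarrow> 'v \<Rightarrow> 'v set" where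
  "in_neighbors G i = {j. (j, i) \<in> parcs G}"

definition out_neighbors :: "'v pair_pre_digraph \<Rightarrow> 'v \<Rightarrow> 'v set" where
  "out_neighbors G i = {j. (i, j) \<in> parcs G}"

definition digraph_dist :: "'v pair_pre_digraph \<Rightarrow> 'v \<Rightarrow> 'v \<Rightarrow> nat" where
  "digraph_dist G u v = (LEAST k. \<exists>p. pre_digraph.apath (with_proj G) u p v \<and> length p = k)"

definition digraph_diam :: "'v pair_pre_digraph \<Rightarrow> nat" where
  "digraph_diam G = Max {digraph_dist G u v | u v. u \<in> pverts G \<and> v \<in> pverts G}"


section \<open>Active constraints consensus\<close>

record 'x acc_state =
  cand :: "nat set"
  obj :: ereal
  sol :: "'x option"
  ncg :: nat

text \<open>
  The message sent along the arc \<open>(i, k)\<close> when \<open>st\<close> gives the current state of each node.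
\<close>

definition acc_message :: "('v \<Rightarrow> 'x acc_state) \<Rightarrow> 'v \<times> 'v \<Rightarrow> ereal \<times> nat set" where
  "acc_message st e = (obj (st (fst e)), cand (st (fst e)))"

definition acc_running :: "nat \<Rightarrow> 'x acc_state \<Rightarrow> bool" where
  "acc_running D s \<longleftrightarrow> ncg s < 2 * D + 1 \<and> obj s < \<infinity>"

definition acc_init ::
    "(real^'d) set \<Rightarrow> real^'d \<Rightarrow> (nat \<Rightarrow> real^'d \<Rightarrow> real) \<Rightarrow> nat set \<Rightarrow> (real^'d) acc_state" where
  "acc_init X a g Ci =
     \<lparr>cand = active_set X a g Ci, obj = J_opt X a g Ci, sol = x_opt X a g Ci, ncg = 1\<rparr>"

text \<open>
  One iteration at a node with local constraints \<open>Ci\<close>, in-neighbors \<open>Nin\<close> and state \<open>s\<close>, where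
  \<open>inbox j\<close> is the message received from \<open>j\<close>.  Exiting the loop needs no separate flag: a
  node that exits because of infeasibility has objective \<open>\<infinity>\<close>, so it is no longer running,
  and a node that is not running keeps its state forever.  In a strongly connected graph, a
  running node has an in-neighbor (otherwise it is the only node and the diameter is 0), so
  \<open>Max\<close> below is always taken over a nonempty set.
\<close>

definition acc_step ::
    "(real^'d) set \<Rightarrow> real^'d \<Rightarrow> (nat \<Rightarrow> real^'d \<Rightarrow> real) \<Rightarrow> nat \<Rightarrow> nat set \<Rightarrow> 'v set
      \<Rightarrow> ('v \<Rightarrow> ereal \<times> nat set) \<Rightarrow> (real^'d) acc_state \<Rightarrow> (real^'d) acc_state" where
  "acc_step X a g D Ci Nin inbox s =
     (if acc_running D s then
        let L = cand s \<union> (\<Union>j\<in>Nin. snd (inbox j)) \<union> Ci;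
            Jbar = Max ((\<lambda>j. fst (inbox j)) ` Nin)
        in if Jbar = \<infinity> then s\<lparr>cand := {}, obj := \<infinity>, sol := None\<rparr>
           else \<lparr>cand = active_set X a g L, obj = J_opt X a g L, sol = x_opt X a g L,
                 ncg = (if J_opt X a g L = obj s then ncg s + 1 else 1)\<rparr>
      else s)"

text \<open>\<open>acc X a g G Cl t i\<close> is the state of node \<open>i\<close> at iteration \<open>t\<close>.\<close>

primrec acc ::
    "(real^'d) set \<Rightarrow> real^'d \<Rightarrow> (nat \<Rightarrow> real^'d \<Rightarrow> real) \<Rightarrow> 'v pair_pre_digraph
      \<Rightarrow> ('v \<Rightarrow> nat set) \<Rightarrow> nat \<Rightarrow> 'v \<Rightarrow> (real^'d) acc_state" where
  "acc X a g G Cl 0 = (\<lambda>i. acc_init X a g (Cl i))"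
| "acc X a g G Cl (Suc t) = (\<lambda>i.
     acc_step X a g (digraph_diam G) (Cl i) (in_neighbors G i)
       (\<lambda>j. acc_message (acc X a g G Cl t) (j, i)) (acc X a g G Cl t i))"

end

theory Submission
  imports Defs
begin

text \<open>
  Convexity makes the active constraints of a feasible program a lossless summary of it:
  discarding the others changes neither value nor solution (\<open>x_opt_active_set\<close>). A node whose next program contains the summaries of its neighbors
  and its own thus has a value at least as large as all theirs and, when the values are equal
  and finite, the same solution, because optima are unique (\<open>obj_flow_step\<close>). Hence the values
  are monotone in time; being optimal values of subsets of the finite set \<open>C\<close>, they settle, and
  every node eventually stops, by its counter or because it is infeasible.

  The delicate point is that the stopping rule is never premature. Let \<open>D\<close> be the diameter and
  consider the first time \<open>t0\<close> at which the counter stops some node \<open>i\<close>. Until then all nodes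
  forward what they receive, and the value of \<open>i\<close> has not changed since \<open>t0 - 2 * D\<close>. In \<open>D\<close>
  iterations this value reaches every node as a lower bound, and in another \<open>D\<close> iterations the
  values of all nodes come back to \<open>i\<close> as lower bounds. So at time \<open>t0 - D\<close> all nodes agree with
  \<open>i\<close> on the value, and by uniqueness on the solution, which therefore satisfies every local
  constraint and is the global optimum (\<open>solution_at_first_halt\<close>). The remaining \<open>D\<close> iterations
  up to \<open>t0\<close> carry each globally active constraint from a node that owns it to all nodes
  (\<open>active_at_first_halt\<close>). From \<open>t0\<close> on every node holds the global value, solution and active
  set, and neither stopping nor iterating can change them. If the counter stops no node, all
  nodes become infeasible, and so is the global program.

  In general position at most as many constraints as there are dimensions vanish at any point
  of the domain, and the candidates of a node all vanish at its current solution, which bounds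
  the size of the messages.
\<close>

section \<open>Convex programs under removal of constraints\<close>

locale convex_program =
  fixes X :: "(real^'d) set" and a :: "real^'d" and g :: "nat \<Rightarrow> real^'d \<Rightarrow> real" and C :: "nat set"
  assumes convex_domain: "convex X"
    and convex_constr: "\<And>j. j \<in> C \<Longrightarrow> convex_on X (g j)"
    and finite_constrs: "finite C"
    and unique_optimum: "unique_minimum_condition X a g C"
begin

lemma optimal_solution_iff:
  "optimal_solution X a g S x \<longleftrightarrow>
     x \<in> feasible_points X g S \<and> (\<forall>y\<in>feasible_points X g S. a \<bullet> x \<le> a \<bullet> y)"
  by (auto simp: optimal_solution_def is_arg_min_def not_less)

lemma x_opt_eq_Some_iff:
  assumes "S \<subseteq> C"
  shows "x_opt X a g S = Some x \<longleftrightarrow> optimal_solution X a g S x"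
proof (cases "feasible_points X g S = {}")
  case True
  then show ?thesis by (simp add: x_opt_def optimal_solution_iff)
next
  case False
  then have ex1: "\<exists>!x. optimal_solution X a g S x"
    using unique_optimum assms by (simp add: unique_minimum_condition_def)
  then show ?thesis
    using False theI'[OF ex1] by (auto simp: x_opt_def)
qed

lemma J_opt_less_infinity_iff: "J_opt X a g S < \<infinity> \<longleftrightarrow> (\<exists>x. x_opt X a g S = Some x)"
  by (simp add: J_opt_def split: option.split)

lemma J_opt_eq_infinity_iff: "J_opt X a g S = \<infinity> \<longleftrightarrow> x_opt X a g S = None"
  by (simp add: J_opt_def split: option.split)

lemma feasible_points_antimono:
  "x \<in> feasible_points X g T \<Longrightarrow> S \<subseteq> T \<Longrightarrow> x \<in> feasible_points X g S"
  by (auto simp: feasible_points_def)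

lemma J_opt_mono:
  assumes "S \<subseteq> T" "T \<subseteq> C"
  shows "J_opt X a g S \<le> J_opt X a g T"
proof (cases "x_opt X a g T")
  case None
  then show ?thesis by (simp add: J_opt_def)
next
  case (Some y)
  then have y: "y \<in> feasible_points X g S"
    using assms feasible_points_antimono[of y T S]
    by (auto simp: x_opt_eq_Some_iff optimal_solution_iff)
  then have "x_opt X a g S \<noteq> None"
    by (auto simp: x_opt_def)
  then obtain x where "x_opt X a g S = Some x"
    by auto
  moreover from this have "a \<bullet> x \<le> a \<bullet> y"
    using y assms by (auto simp: x_opt_eq_Some_iff optimal_solution_iff)
  ultimately show ?thesis using Some by (simp add: J_opt_def)
qed

text \<open>
  The optimum of the tighter program is feasible for the looser one, and equal values make it
  optimal there; the optimum being unique, the two solutions agree.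
\<close>

lemma x_opt_eq_if_J_opt_eq:
  assumes "S \<subseteq> T" "T \<subseteq> C" "J_opt X a g S = J_opt X a g T"
  shows "x_opt X a g S = x_opt X a g T"
proof (cases "x_opt X a g T")
  case None
  then show ?thesis using assms J_opt_eq_infinity_iff by metis
next
  case (Some y)
  then have "J_opt X a g S < \<infinity>"
    using assms(3) by (simp add: J_opt_def)
  then obtain x where x: "x_opt X a g S = Some x"
    using J_opt_less_infinity_iff by auto
  then have "a \<bullet> x = a \<bullet> y"
    using Some assms(3) by (simp add: J_opt_def)
  moreover have "y \<in> feasible_points X g S"
    using Some assms feasible_points_antimono[of y T S]
    by (auto simp: x_opt_eq_Some_iff optimal_solution_iff)
  ultimately have "optimal_solution X a g S y"
    using x assms by (auto simp: x_opt_eq_Some_iff optimal_solution_iff)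
  then show ?thesis
    using Some assms x_opt_eq_Some_iff[of S y] by auto
qed

lemma active_set_eq_if_x_opt_eq:
  assumes "S \<subseteq> T" "x_opt X a g S = x_opt X a g T"
  shows "active_set X a g S = active_set X a g T \<inter> S"
  using assms by (auto simp: active_set_def split: option.split)

lemma active_set_subset: "active_set X a g S \<subseteq> S"
  by (auto simp: active_set_def split: option.split)

text \<open>
  This is the only place where convexity enters. If some point met the active constraints and
  had a smaller objective than the optimum, a short step from the optimum towards it would
  stay within the active constraints by convexity, and within the finitely many others because
  they have slack at the optimum, contradicting optimality.
\<close>

lemma x_opt_active_set:
  assumes "S \<subseteq> C" "x_opt X a g S = Some x"
  shows "x_opt X a g (active_set X a g S) = Some x"
proof -
  let ?A = "active_set X a g S"
  have A: "?A = {j \<in> S. g j x = 0}"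
    using assms(2) by (simp add: active_set_def)
  have opt: "optimal_solution X a g S x"
    using assms by (simp add: x_opt_eq_Some_iff)
  have xX: "x \<in> X" and xS: "\<And>j. j \<in> S \<Longrightarrow> g j x \<le> 0"
    using opt by (auto simp: optimal_solution_iff feasible_points_def)
  have "a \<bullet> x \<le> a \<bullet> y" if "y \<in> feasible_points X g ?A" for y
  proof (rule ccontr)
    assume less: "\<not> a \<bullet> x \<le> a \<bullet> y"
    have yX: "y \<in> X" and yA: "\<And>j. j \<in> ?A \<Longrightarrow> g j y \<le> 0"
      using that by (auto simp: feasible_points_def)
    define z where "z \<epsilon> = (1 - \<epsilon>) *\<^sub>R x + \<epsilon> *\<^sub>R y" for \<epsilon> :: real
    have convex_bound: "g j (z \<epsilon>) \<le> (1 - \<epsilon>) * g j x + \<epsilon> * g j y"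
      if "j \<in> S" "0 < \<epsilon>" "\<epsilon> < 1" for j \<epsilon>
      unfolding z_def using convex_onD[OF convex_constr, of j \<epsilon> x y] that xX yX assms(1) by auto
    have "\<forall>\<^sub>F \<epsilon> in at_right 0. (1 - \<epsilon>) * g j x + \<epsilon> * g j y \<le> 0" if j: "j \<in> S" for j
    proof (cases "j \<in> ?A")
      case True
      then have "g j x = 0" "g j y \<le> 0"
        using A yA by auto
      then show ?thesis
        using eventually_at_right_less[of "0 :: real"]
        by (auto elim!: eventually_mono simp: mult_nonneg_nonpos)
    next
      case False
      then have neg: "g j x < 0"
        using A xS[OF j] j by force
      have "((\<lambda>\<epsilon>. (1 - \<epsilon>) * g j x + \<epsilon> * g j y) \<longlongrightarrow> (1 - 0) * g j x + 0 * g j y) (at_right 0)"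
        by (intro tendsto_intros)
      then have "\<forall>\<^sub>F \<epsilon> in at_right 0. (1 - \<epsilon>) * g j x + \<epsilon> * g j y < 0"
        using neg by (intro order_tendstoD(2)) auto
      then show ?thesis by (auto elim!: eventually_mono)
    qed
    then have "\<forall>\<^sub>F \<epsilon> in at_right 0. \<forall>j\<in>S. (1 - \<epsilon>) * g j x + \<epsilon> * g j y \<le> 0"
      using finite_subset[OF assms(1) finite_constrs] by (simp add: eventually_ball_finite)
    then have "\<forall>\<^sub>F \<epsilon> in at_right 0. (\<forall>j\<in>S. (1 - \<epsilon>) * g j x + \<epsilon> * g j y \<le> 0) \<and> \<epsilon> \<in> {0<..<1}"
      using eventually_at_right_real[of 0 1] by (intro eventually_conj) auto
    then obtain \<epsilon> :: real where \<epsilon>: "0 < \<epsilon>" "\<epsilon> < 1"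
      and slack: "\<And>j. j \<in> S \<Longrightarrow> (1 - \<epsilon>) * g j x + \<epsilon> * g j y \<le> 0"
      using eventually_happens'[OF trivial_limit_at_right_real, of _ "0 :: real"] by force
    have "z \<epsilon> \<in> X"
      unfolding z_def using convex_domain xX yX \<epsilon> by (intro convexD) auto
    then have "z \<epsilon> \<in> feasible_points X g S"
      using convex_bound slack \<epsilon> order_trans by (fastforce simp: feasible_points_def)
    then have "a \<bullet> x \<le> a \<bullet> z \<epsilon>"
      using opt by (simp add: optimal_solution_iff)
    then have "0 \<le> \<epsilon> * (a \<bullet> y - a \<bullet> x)"
      by (simp add: z_def inner_add_right algebra_simps)
    then show False
      using \<epsilon> less by (simp add: zero_le_mult_iff)
  qed
  then show ?thesis
    using opt assms(1) active_set_subset[of S] feasible_points_antimono[of x S ?A]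
    by (subst x_opt_eq_Some_iff) (auto simp: optimal_solution_iff)
qed

text \<open>
  This is how a node compares with a sender: \<open>S\<close> is the program solved by the sender, and \<open>T\<close> the
  next program of the receiver, which contains the sender's active constraints but perhaps not \<open>S\<close>.
\<close>

lemma J_opt_le_if_active_set_subset:
  assumes "S \<subseteq> C" "J_opt X a g S < \<infinity>" "active_set X a g S \<subseteq> T" "T \<subseteq> C"
  shows "J_opt X a g S \<le> J_opt X a g T"
    and "J_opt X a g S = J_opt X a g T \<Longrightarrow> x_opt X a g S = x_opt X a g T"
proof -
  obtain x where "x_opt X a g S = Some x"
    using assms(2) J_opt_less_infinity_iff by auto
  then have x: "x_opt X a g (active_set X a g S) = x_opt X a g S"
    using x_opt_active_set assms(1) by auto
  then have J: "J_opt X a g (active_set X a g S) = J_opt X a g S"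
    by (simp add: J_opt_def)
  show "J_opt X a g S \<le> J_opt X a g T"
    using J_opt_mono[OF assms(3,4)] J by simp
  show "J_opt X a g S = J_opt X a g T \<Longrightarrow> x_opt X a g S = x_opt X a g T"
    using x_opt_eq_if_J_opt_eq[OF assms(3,4)] x J by simp
qed

lemma x_opt_eq_if_feasible:
  assumes "S \<subseteq> C" "x_opt X a g S = Some x" "x \<in> feasible_points X g C"
  shows "x_opt X a g C = Some x"
  using assms by (auto simp: x_opt_eq_Some_iff optimal_solution_iff dest: feasible_points_antimono)

lemma card_active_set_le:
  assumes "general_position X g C" "S \<subseteq> C"
  shows "card (active_set X a g S) \<le> CARD('d)"
proof (cases "x_opt X a g S")
  case None
  then show ?thesis by (simp add: active_set_def)
next
  case (Some x)
  then have "x \<in> X"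
    using assms(2) by (auto simp: x_opt_eq_Some_iff optimal_solution_iff feasible_points_def)
  then have "card {j \<in> C. g j x = 0} \<le> CARD('d)"
    using assms(1) by (simp add: general_position_def)
  moreover have "card (active_set X a g S) \<le> card {j \<in> C. g j x = 0}"
    using Some assms(2) finite_constrs by (intro card_mono) (auto simp: active_set_def)
  ultimately show ?thesis by simp
qed

end


section \<open>Walks bounded by the diameter\<close>

lemma relpow_reflcl_extend:
  assumes "(u, v) \<in> R ^^ k" "k \<le> m"
  shows "(u, v) \<in> (R\<^sup>=) ^^ m"
proof -
  have "(u, v) \<in> (R\<^sup>=) ^^ (k + l)" for l
  proof (induction l)
    case 0
    have "(u, v) \<in> (R\<^sup>=) ^^ k"
      using assms(1) by (induction k arbitrary: v) auto
    then show ?case by simp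
  next
    case (Suc l)
    then show ?case by auto
  qed
  from this[of "m - k"] show ?thesis
    using assms(2) by simp
qed

context pair_wf_digraph
begin

lemma awalk_imp_relpow: "awalk u p v \<Longrightarrow> (u, v) \<in> parcs G ^^ length p"
proof (induction p arbitrary: u)
  case (Cons e p)
  then have "(u, snd e) \<in> parcs G" "(snd e, v) \<in> parcs G ^^ length p"
    by (auto simp: awalk_Cons_iff)
  then have "(u, v) \<in> parcs G ^^ Suc (length p)"
    by (rule relpow_Suc_I2)
  then show ?case by simp
qed (simp add: awalk_Nil_iff)

lemma digraph_dist_relpow:
  assumes "u \<rightarrow>\<^sup>*\<^bsub>with_proj G\<^esub> v"
  shows "(u, v) \<in> parcs G ^^ digraph_dist G u v"
proof -
  have "\<exists>k p. apath u p v \<and> length p = k"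
    using assms reachable_apath by blast
  then have "\<exists>p. apath u p v \<and> length p = digraph_dist G u v"
    unfolding digraph_dist_def by (rule LeastI_ex)
  then show ?thesis
    unfolding apath_def by (metis awalk_imp_relpow)
qed

text \<open>
  Idle steps are admitted so that any two nodes are joined by a walk of length exactly the
  diameter. They match the algorithm, where a node also passes its candidates to itself.
\<close>

lemma relpow_digraph_diam:
  assumes "finite (pverts G)" "strongly_connected (with_proj G)"
    and "u \<in> pverts G" "v \<in> pverts G"
  shows "(u, v) \<in> ((parcs G)\<^sup>=) ^^ digraph_diam G"
proof (rule relpow_reflcl_extend)
  show "(u, v) \<in> parcs G ^^ digraph_dist G u v"
    using assms(2-4) by (intro digraph_dist_relpow) (auto simp: strongly_connected_def)
  have "finite {digraph_dist G u v | u v. u \<in> pverts G \<and> v \<in> pverts G}"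
    using assms(1) by (intro finite_image_set2) auto
  then show "digraph_dist G u v \<le> digraph_diam G"
    unfolding digraph_diam_def using assms(3,4) by (intro Max_ge) blast+
qed

text \<open>
  With positive diameter there are at least two nodes, and a walk of positive length that
  ends at the given node.
\<close>

lemma in_neighbors_nonempty:
  assumes "strongly_connected (with_proj G)" "v \<in> pverts G" "digraph_diam G > 0"
  shows "in_neighbors G v \<noteq> {}"
proof -
  have "\<exists>u\<in>pverts G. u \<noteq> v"
  proof (rule ccontr)
    assume "\<not> (\<exists>u\<in>pverts G. u \<noteq> v)"
    then have V: "pverts G = {v}"
      using assms(2) by blast
    have "digraph_dist G v v = 0"
      unfolding digraph_dist_def using assms(2) by (intro Least_eq_0) (simp add: apath_Nil_iff)
    then have "{digraph_dist G u w | u w. u \<in> pverts G \<and> w \<in> pverts G} = {0}"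
      unfolding V by auto
    then have "digraph_diam G = 0"
      by (simp add: digraph_diam_def)
    then show False
      using assms(3) by simp
  qed
  then obtain u where u: "u \<in> pverts G" "u \<noteq> v"
    by auto
  then have "(u, v) \<in> parcs G ^^ digraph_dist G u v"
    using assms(1,2) by (intro digraph_dist_relpow) (auto simp: strongly_connected_def)
  then show ?thesis
    using u(2) by (cases "digraph_dist G u v") (auto simp: in_neighbors_def)
qed

end


section \<open>Invariants of the consensus algorithm\<close>

locale acc_network = convex_program X a g C + pair_wf_digraph G
  for X :: "(real^'d) set" and a :: "real^'d" and g :: "nat \<Rightarrow> real^'d \<Rightarrow> real" and C :: "nat set"
    and G :: "'v pair_pre_digraph" +
  fixes Cl :: "'v \<Rightarrow> nat set"
  assumes finite_nodes: "finite (pverts G)"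
    and connected: "strongly_connected (with_proj G)"
    and local_constrs: "(\<Union>v\<in>pverts G. Cl v) = C"
begin

declare acc.simps(2) [simp del]

abbreviation "state \<equiv> acc X a g G Cl"

abbreviation "D \<equiv> digraph_diam G"

abbreviation "links \<equiv> (parcs G)\<^sup>="

definition solves :: "nat set \<Rightarrow> (real^'d) acc_state \<Rightarrow> bool" where
  "solves L s \<longleftrightarrow> cand s = active_set X a g L \<and> obj s = J_opt X a g L \<and> sol s = x_opt X a g L"

text \<open>
  Stopping by the counter, as opposed to stopping by infeasibility: an infeasible node already
  dominates whatever its neighbors send, so it never blocks the flow of objective values.
\<close>

definition halted :: "(real^'d) acc_state \<Rightarrow> bool" where
  "halted s \<longleftrightarrow> 2 * D + 1 \<le> ncg s \<and> obj s < \<infinity>"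

lemma state_halted: "halted (state t v) \<Longrightarrow> state (Suc t) v = state t v"
  by (simp add: acc.simps(2) acc_step_def acc_running_def halted_def)

lemma state_infinite: "obj (state t v) = \<infinity> \<Longrightarrow> state (Suc t) v = state t v"
  by (simp add: acc.simps(2) acc_step_def acc_running_def)

lemma local_constrs_subset: "v \<in> pverts G \<Longrightarrow> Cl v \<subseteq> C"
  using local_constrs by auto

lemma finite_in_neighbors: "finite (in_neighbors G v)"
  using finite_nodes by (rule finite_subset[rotated]) (auto simp: in_neighbors_def dest: in_arcsD1)

lemma links_node: "(u, v) \<in> links \<Longrightarrow> v \<in> pverts G \<Longrightarrow> u \<in> pverts G"
  by (auto dest: in_arcsD1)

lemma ncg_pos: "1 \<le> ncg (state t v)"
  by (induction t) (auto simp: acc_init_def acc.simps(2) acc_step_def Let_def)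

text \<open>
  The maximum over the values received is meaningful only for a node that receives some. A node
  without in-neighbors never runs: the diameter is then zero, and the counter starts at one.
\<close>

lemma running_in_neighbors_nonempty:
  assumes "v \<in> pverts G" "acc_running D (state t v)"
  shows "in_neighbors G v \<noteq> {}"
  using assms ncg_pos[of t v] connected in_neighbors_nonempty by (auto simp: acc_running_def)

lemma state_step_cases:
  assumes v: "v \<in> pverts G" and run: "acc_running D (state t v)"
  obtains
    (infeasible) u where "u \<in> in_neighbors G v" "obj (state t u) = \<infinity>"
      "state (Suc t) v = (state t v)\<lparr>cand := {}, obj := \<infinity>, sol := None\<rparr>"
  | (solve) L where "L = cand (state t v) \<union> (\<Union>u\<in>in_neighbors G v. cand (state t u)) \<union> Cl v"
      "\<And>u. u \<in> in_neighbors G v \<Longrightarrow> obj (state t u) < \<infinity>"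
      "solves L (state (Suc t) v)"
      "ncg (state (Suc t) v)
         = (if obj (state (Suc t) v) = obj (state t v) then ncg (state t v) + 1 else 1)"
proof -
  let ?M = "(\<lambda>u. obj (state t u)) ` in_neighbors G v"
  have M: "finite ?M" "?M \<noteq> {}"
    using finite_in_neighbors running_in_neighbors_nonempty[OF v run] by auto
  show thesis
  proof (cases "Max ?M = \<infinity>")
    case True
    then have "\<infinity> \<in> ?M"
      using Max_in[OF M] by simp
    then obtain u where "u \<in> in_neighbors G v" "obj (state t u) = \<infinity>"
      by auto
    then show thesis
      using True run by (intro infeasible) (auto simp: acc.simps(2) acc_step_def acc_message_def Let_def)
  next
    case False
    have fin: "obj (state t u) < \<infinity>" if "u \<in> in_neighbors G v" for u
    proof -
      have "obj (state t u) \<le> Max ?M"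
        using M(1) that by (intro Max_ge) auto
      also have "\<dots> < \<infinity>"
        using False by simp
      finally show ?thesis .
    qed
    show thesis
      using False run fin
      by (intro solve[OF refl]) (auto simp: acc.simps(2) acc_step_def acc_message_def Let_def solves_def)
  qed
qed

text \<open>
  For a node that learns of infeasibility from a neighbor, \<open>L\<close> is \<open>C\<close> itself: some subset of \<open>C\<close> is
  infeasible, hence so is \<open>C\<close>, and the data of an infeasible program do not depend on its constraints.
\<close>

lemma state_solves:
  assumes "v \<in> pverts G"
  shows "\<exists>L. Cl v \<subseteq> L \<and> L \<subseteq> C \<and> solves L (state t v)"
  using assms
proof (induction t arbitrary: v)
  case 0
  then show ?case
    using local_constrs_subset by (intro exI[of _ "Cl v"]) (simp add: acc_init_def solves_def)
next
  case (Suc t)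
  have cand: "cand (state t u) \<subseteq> C" if "u \<in> pverts G" for u
    using Suc.IH[OF that] active_set_subset by (fastforce simp: solves_def)
  show ?case
  proof (cases "acc_running D (state t v)")
    case False
    then have "state (Suc t) v = state t v"
      by (simp add: acc.simps(2) acc_step_def)
    then show ?thesis
      using Suc.IH[OF Suc.prems] by metis
  next
    case True
    with Suc.prems show ?thesis
    proof (cases rule: state_step_cases)
      case (infeasible u)
      then have "u \<in> pverts G"
        by (auto simp: in_neighbors_def dest: in_arcsD1)
      from Suc.IH[OF this] infeasible(2) obtain L where "L \<subseteq> C" "J_opt X a g L = \<infinity>"
        by (auto simp: solves_def)
      then have "J_opt X a g C = \<infinity>"
        using J_opt_mono[of L C] by simp
      then have "solves C (state (Suc t) v)"
        using J_opt_eq_infinity_iff[of C] unfolding infeasible(3)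
        by (simp add: solves_def active_set_def)
      then show ?thesis
        using local_constrs_subset[OF Suc.prems] by blast
    next
      case (solve L)
      have "L \<subseteq> C"
        using solve(1) cand Suc.prems local_constrs_subset[OF Suc.prems]
        by (auto simp: in_neighbors_def dest: in_arcsD1)
      moreover have "Cl v \<subseteq> L"
        by (simp add: solve(1))
      ultimately show ?thesis
        using solve(3) by auto
    qed
  qed
qed

lemma cand_subset: "v \<in> pverts G \<Longrightarrow> cand (state t v) \<subseteq> C"
  using state_solves[of v t] active_set_subset by (fastforce simp: solves_def)

lemma obj_le_J_opt: "v \<in> pverts G \<Longrightarrow> obj (state t v) \<le> J_opt X a g C"
  using state_solves[of v t] J_opt_mono by (auto simp: solves_def)

lemma state_step_solves:
  assumes v: "v \<in> pverts G" and "\<not> halted (state t v)" and fin: "obj (state (Suc t) v) < \<infinity>"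
  shows "\<exists>L. Cl v \<subseteq> L \<and> L \<subseteq> C \<and> solves L (state (Suc t) v)
           \<and> (\<forall>u. (u, v) \<in> links \<longrightarrow> cand (state t u) \<subseteq> L \<and> obj (state t u) < \<infinity>)"
proof -
  have fin_t: "obj (state t v) < \<infinity>"
    using fin state_infinite[of t v] by fastforce
  then have "acc_running D (state t v)"
    using assms(2) by (simp add: acc_running_def halted_def)
  with v show ?thesis
  proof (cases rule: state_step_cases)
    case (infeasible u)
    then show ?thesis
      using fin by simp
  next
    case (solve L)
    have "cand (state t u) \<subseteq> C" if "u \<in> in_neighbors G v" for u
      using that cand_subset by (auto simp: in_neighbors_def dest: in_arcsD1)
    then have "L \<subseteq> C"
      using solve(1) cand_subset[OF v] local_constrs_subset[OF v] by blast
    moreover have "Cl v \<subseteq> L"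
      by (simp add: solve(1))
    moreover have "cand (state t u) \<subseteq> L \<and> obj (state t u) < \<infinity>" if "(u, v) \<in> links" for u
      using that solve(1,2) fin_t by (auto simp: in_neighbors_def)
    ultimately show ?thesis
      using solve(3) by blast
  qed
qed

text \<open>
  Links include the loop at \<open>v\<close>, so this also compares a node with its own previous state.
\<close>

lemma obj_flow_step:
  assumes v: "v \<in> pverts G" and "\<not> halted (state t v)" and uv: "(u, v) \<in> links"
  shows "obj (state t u) \<le> obj (state (Suc t) v)"
    and "obj (state t u) = obj (state (Suc t) v) \<Longrightarrow> obj (state (Suc t) v) < \<infinity>
           \<Longrightarrow> sol (state t u) = sol (state (Suc t) v)"
proof -
  have *: "obj (state t u) \<le> obj (state (Suc t) v)
      \<and> (obj (state t u) = obj (state (Suc t) v) \<longrightarrow> sol (state t u) = sol (state (Suc t) v))"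
    if fin: "obj (state (Suc t) v) < \<infinity>"
  proof -
    obtain L where L: "L \<subseteq> C" "solves L (state (Suc t) v)" "cand (state t u) \<subseteq> L"
        "obj (state t u) < \<infinity>"
      using state_step_solves[OF assms(1,2) fin] uv by blast
    obtain S where S: "S \<subseteq> C" "solves S (state t u)"
      using state_solves links_node[OF uv v] by blast
    show ?thesis
      using J_opt_le_if_active_set_subset[of S L] L S by (simp add: solves_def)
  qed
  show "obj (state t u) \<le> obj (state (Suc t) v)"
    using * by (cases "obj (state (Suc t) v) = \<infinity>") (simp_all)
  show "obj (state t u) = obj (state (Suc t) v) \<Longrightarrow> obj (state (Suc t) v) < \<infinity>
           \<Longrightarrow> sol (state t u) = sol (state (Suc t) v)"
    using * by blast
qed

lemma obj_mono:
  assumes v: "v \<in> pverts G"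
  shows "mono (\<lambda>t. obj (state t v))"
proof (rule incseq_SucI)
  fix t
  show "obj (state t v) \<le> obj (state (Suc t) v)"
    using state_halted[of t v] obj_flow_step(1)[OF v] by (cases "halted (state t v)") auto
qed

lemma obj_flow:
  assumes "(u, v) \<in> links ^^ k" "v \<in> pverts G"
    and "\<And>s w. s < t + k \<Longrightarrow> w \<in> pverts G \<Longrightarrow> \<not> halted (state s w)"
  shows "obj (state t u) \<le> obj (state (t + k) v)"
  using assms
proof (induction k arbitrary: v)
  case (Suc k)
  then obtain w where w: "(u, w) \<in> links ^^ k" "(w, v) \<in> links"
    by auto
  then have "w \<in> pverts G"
    using links_node Suc.prems(2) by blast
  then have "obj (state t u) \<le> obj (state (t + k) w)"
    using Suc w by auto
  also have "\<dots> \<le> obj (state (Suc (t + k)) v)"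
    using Suc.prems w by (intro obj_flow_step(1)) auto
  finally show ?case by simp
qed auto

text \<open>
  At a node that has not become infeasible, a counter value of \<open>m\<close> certifies that the last \<open>m\<close>
  objective values coincide.
\<close>

lemma obj_const_if_ncg:
  assumes "v \<in> pverts G" "obj (state t v) < \<infinity>" "s \<le> t" "t < s + ncg (state t v)"
  shows "obj (state s v) = obj (state t v)"
  using assms
proof (induction t)
  case (Suc t)
  have fin: "obj (state t v) < \<infinity>"
    using Suc.prems(2) state_infinite[of t v] by fastforce
  show ?case
  proof (cases "s = Suc t")
    case False
    then have s: "s \<le> t"
      using Suc.prems by simp
    show ?thesis
    proof (cases "acc_running D (state t v)")
      case False
      then have "state (Suc t) v = state t v"
        by (simp add: acc.simps(2) acc_step_def)
      then show ?thesis
        using Suc.IH Suc.prems s by simp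
    next
      case True
      with Suc.prems(1) show ?thesis
      proof (cases rule: state_step_cases)
        case (infeasible u)
        then show ?thesis
          using Suc.prems(2) by simp
      next
        case (solve L)
        then show ?thesis
          using Suc.IH Suc.prems s fin by (auto split: if_splits)
      qed
    qed
  qed simp
qed simp

lemma ncg_le: "v \<in> pverts G \<Longrightarrow> ncg (state t v) \<le> t + 1"
  by (induction t) (auto simp: acc_init_def acc.simps(2) acc_step_def Let_def)

lemma ncg_grows:
  assumes v: "v \<in> pverts G"
    and const: "\<And>t. t1 \<le> t \<Longrightarrow> obj (state t v) = J" and "J < \<infinity>"
    and "\<And>t. \<not> halted (state t v)"
  shows "k \<le> ncg (state (t1 + k) v)"
proof (induction k)
  case (Suc k)
  have J: "obj (state (t1 + k) v) = J" "obj (state (Suc (t1 + k)) v) = J"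
    by (rule const, simp)+
  then have "acc_running D (state (t1 + k) v)"
    using assms(3) assms(4)[of "t1 + k"] by (simp add: acc_running_def halted_def)
  with v show ?case
  proof (cases rule: state_step_cases)
    case (infeasible u)
    then show ?thesis
      using J assms(3) by simp
  next
    case (solve L)
    then show ?thesis
      using J Suc.IH by simp
  qed
qed simp

text \<open>
  Objective values are optimal values of subsets of \<open>C\<close>, so there are finitely many of them and a
  monotone sequence of them is eventually constant; at a node that
  kept running, the counter would then grow past any bound.
\<close>

lemma eventually_halted_or_infinite:
  assumes v: "v \<in> pverts G"
  shows "\<exists>t. halted (state t v) \<or> obj (state t v) = \<infinity>"
proof (rule ccontr)
  assume "\<nexists>t. halted (state t v) \<or> obj (state t v) = \<infinity>"
  then have not_halted: "\<not> halted (state t v)" and fin: "obj (state t v) < \<infinity>" for t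
    by auto
  let ?R = "range (\<lambda>t. obj (state t v))"
  have "?R \<subseteq> J_opt X a g ` Pow C"
    using state_solves[OF v] by (fastforce simp: solves_def)
  then have R: "finite ?R"
    by (rule finite_subset) (simp add: finite_constrs)
  obtain t1 where t1: "obj (state t1 v) = Max ?R"
    using Max_in[OF R] by auto
  have "obj (state t v) = obj (state t1 v)" if "t1 \<le> t" for t
    using monoD[OF obj_mono[OF v] that] Max_ge[OF R, of "obj (state t v)"] t1 by simp
  then have "2 * D + 1 \<le> ncg (state (t1 + (2 * D + 1)) v)"
    by (rule ncg_grows[OF v _ fin not_halted])
  then show False
    using not_halted[of "t1 + (2 * D + 1)"] fin by (simp add: halted_def)
qed


section \<open>Correctness of the stopping rule\<close>

text \<open>
  An objective value travels from \<open>i\<close> to any other node and back in twice the diameter many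
  iterations, provided that no node has stopped; this is why the first halt is considered. If
  the value at \<open>i\<close> did not grow meanwhile, then half way through every node holds the value of \<open>i\<close>,
  and by uniqueness of optima also the solution of \<open>i\<close>. That solution therefore satisfies the
  local constraints of every node, hence solves the global program.
\<close>

lemma solution_at_first_halt:
  assumes i: "i \<in> pverts G" and halt: "halted (state t0 i)"
    and first: "\<forall>s<t0. \<forall>w\<in>pverts G. \<not> halted (state s w)"
    and v: "v \<in> pverts G"
  shows "D \<le> t0" and "J_opt X a g C < \<infinity>" and "obj (state (t0 - D) v) = J_opt X a g C"
proof -
  define \<tau> where "\<tau> = t0 - 2 * D"
  have t0: "t0 = \<tau> + 2 * D"
    using halt ncg_le[OF i, of t0] by (simp add: \<tau>_def halted_def)
  then show "D \<le> t0"
    by simp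
  define J where "J = obj (state t0 i)"
  have fin: "J < \<infinity>"
    using halt by (simp add: J_def halted_def)
  have const: "obj (state s i) = J" if "\<tau> \<le> s" "s \<le> t0" for s
    unfolding J_def using i halt that t0 by (intro obj_const_if_ncg) (auto simp: halted_def)
  \<comment> \<open>The way back: a larger value anywhere would have reached \<open>i\<close> by time \<open>t0\<close>.\<close>
  have upper: "obj (state (\<tau> + k) w) \<le> J" if "k \<le> D" "w \<in> pverts G" for k w
  proof -
    have "obj (state (\<tau> + k) w) \<le> obj (state (\<tau> + k + D) i)"
      using that i first t0 relpow_digraph_diam[OF finite_nodes connected]
      by (intro obj_flow) auto
    also have "\<dots> = J"
      using that t0 by (intro const) auto
    finally show ?thesis .
  qed
  \<comment> \<open>The way out: along a walk from \<open>i\<close> values can only grow, so the upper bound pins them to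
    \<open>J\<close>, and equal values on a link mean equal solutions.\<close>
  have same: "obj (state (\<tau> + k) w) = J \<and> sol (state (\<tau> + k) w) = sol (state \<tau> i)"
    if "(i, w) \<in> links ^^ k" "k \<le> D" "w \<in> pverts G" for k w
    using that
  proof (induction k arbitrary: w)
    case 0
    then show ?case
      using const[of \<tau>] t0 by simp
  next
    case (Suc k)
    then obtain u where u: "(i, u) \<in> links ^^ k" "(u, w) \<in> links"
      by auto
    have "u \<in> pverts G"
      using links_node u Suc.prems by blast
    then have IH: "obj (state (\<tau> + k) u) = J" "sol (state (\<tau> + k) u) = sol (state \<tau> i)"
      using Suc u by auto
    have run: "\<not> halted (state (\<tau> + k) w)"
      using first Suc.prems t0 by auto
    note step = obj_flow_step[OF Suc.prems(3) run u(2)]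
    have "obj (state (Suc (\<tau> + k)) w) = J"
      using step(1) upper[of "Suc k" w] IH Suc.prems by simp
    then show ?case
      using step(2) IH fin by simp
  qed
  have mid: "obj (state (\<tau> + D) w) = J \<and> sol (state (\<tau> + D) w) = sol (state \<tau> i)"
    if "w \<in> pverts G" for w
    using same that i relpow_digraph_diam[OF finite_nodes connected] by blast
  obtain S where S: "S \<subseteq> C" "solves S (state (\<tau> + D) i)"
    using state_solves[OF i] by blast
  then obtain x where x: "x_opt X a g S = Some x" "sol (state \<tau> i) = Some x"
    using mid[OF i] fin J_opt_less_infinity_iff by (auto simp: solves_def)
  have "x \<in> X \<and> (\<forall>j\<in>Cl w. g j x \<le> 0)" if "w \<in> pverts G" for w
  proof -
    obtain L where L: "Cl w \<subseteq> L" "L \<subseteq> C" "solves L (state (\<tau> + D) w)"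
      using state_solves[OF \<open>w \<in> pverts G\<close>] by blast
    then have "x_opt X a g L = Some x"
      using mid[OF that] x by (simp add: solves_def)
    then show ?thesis
      using L by (auto simp: x_opt_eq_Some_iff optimal_solution_iff feasible_points_def)
  qed
  then have "x \<in> feasible_points X g C"
    using v local_constrs by (auto simp: feasible_points_def)
  then have "x_opt X a g C = Some x"
    using S x x_opt_eq_if_feasible by blast
  then have J: "J_opt X a g C = J"
    using mid[OF i] S x by (simp add: solves_def J_opt_def)
  then show "J_opt X a g C < \<infinity>"
    using fin by simp
  have "t0 - D = \<tau> + D"
    using t0 by simp
  then show "obj (state (t0 - D) v) = J_opt X a g C"
    using mid[OF v] J by simp
qed

text \<open>
  The program a node has solved uses a subset of \<open>C\<close>, so having the right value already forces the
  right solution; the candidates, however, are right only as far as the node knows the constraints.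
\<close>

lemma solves_if_optimal_value:
  assumes "v \<in> pverts G" "obj (state t v) = J_opt X a g C"
  shows "sol (state t v) = x_opt X a g C"
    and "active_set X a g C \<inter> Cl v \<subseteq> cand (state t v)"
    and "cand (state t v) \<subseteq> active_set X a g C"
proof -
  obtain L where L: "Cl v \<subseteq> L" "L \<subseteq> C" "solves L (state t v)"
    using state_solves[OF assms(1)] by blast
  then have "x_opt X a g L = x_opt X a g C"
    using assms(2) x_opt_eq_if_J_opt_eq[of L C] by (simp add: solves_def)
  with L active_set_eq_if_x_opt_eq[of L C] show "sol (state t v) = x_opt X a g C"
    "active_set X a g C \<inter> Cl v \<subseteq> cand (state t v)"
    "cand (state t v) \<subseteq> active_set X a g C"
    by (auto simp: solves_def)
qed

lemma active_flow_step:
  assumes v: "v \<in> pverts G" and "\<not> halted (state t v)" and uv: "(u, v) \<in> links"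
    and opt: "obj (state (Suc t) v) = J_opt X a g C" and "J_opt X a g C < \<infinity>"
    and c: "c \<in> cand (state t u)" "c \<in> active_set X a g C"
  shows "c \<in> cand (state (Suc t) v)"
proof -
  obtain L where L: "L \<subseteq> C" "solves L (state (Suc t) v)" "cand (state t u) \<subseteq> L"
    using state_step_solves[OF v assms(2)] assms(5) opt uv by (metis (no_types, lifting))
  then have "x_opt X a g L = x_opt X a g C"
    using opt x_opt_eq_if_J_opt_eq[of L C] by (simp add: solves_def)
  then show ?thesis
    using L c active_set_eq_if_x_opt_eq[of L C] by (auto simp: solves_def)
qed

text \<open>
  The constraints active at the global optimum have as many iterations as the diameter to
  spread from the nodes that know them, between the moment all nodes agree on the optimum and
  the first halt. Nodes that stop later cannot interfere: everyone has the full active set by then.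
\<close>

lemma active_at_first_halt:
  assumes i: "i \<in> pverts G" and halt: "halted (state t0 i)"
    and first: "\<forall>s<t0. \<forall>w\<in>pverts G. \<not> halted (state s w)"
    and v: "v \<in> pverts G"
  shows "active_set X a g C \<subseteq> cand (state t0 v)"
proof
  fix c
  assume c: "c \<in> active_set X a g C"
  note facts = solution_at_first_halt[OF i halt first]
  obtain w where w: "w \<in> pverts G" "c \<in> Cl w"
    using c active_set_subset[of C] local_constrs by auto
  have opt: "obj (state (t0 - D + k) u) = J_opt X a g C" if "u \<in> pverts G" for k u
    using monoD[OF obj_mono[OF that], of "t0 - D" "t0 - D + k"] facts(3)[OF that]
      obj_le_J_opt[OF that] by (intro antisym) auto
  have "c \<in> cand (state (t0 - D + k) u)" if "(w, u) \<in> links ^^ k" "k \<le> D" "u \<in> pverts G" for k u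
    using that
  proof (induction k arbitrary: u)
    case 0
    then show ?case
      using solves_if_optimal_value(2)[OF w(1)] opt[OF w(1), of 0] c w(2) by auto
  next
    case (Suc k)
    then obtain z where z: "(w, z) \<in> links ^^ k" "(z, u) \<in> links"
      by auto
    have zV: "z \<in> pverts G"
      using links_node z Suc.prems by blast
    have run: "\<not> halted (state (t0 - D + k) u)"
      using first Suc.prems facts(1)[OF v] by auto
    have "c \<in> cand (state (Suc (t0 - D + k)) u)"
    proof (rule active_flow_step[OF Suc.prems(3) run z(2)])
      show "obj (state (Suc (t0 - D + k)) u) = J_opt X a g C"
        using opt[OF Suc.prems(3), of "Suc k"] by simp
      show "J_opt X a g C < \<infinity>"
        using facts(2)[OF v] .
      show "c \<in> cand (state (t0 - D + k) z)"
        using Suc z zV by simp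
      show "c \<in> active_set X a g C"
        by (rule c)
    qed
    then show ?case by simp
  qed
  from this[of v D] show "c \<in> cand (state t0 v)"
    using relpow_digraph_diam[OF finite_nodes connected w(1) v] v facts(1)[OF v] by auto
qed

lemma converged_after_first_halt:
  assumes i: "i \<in> pverts G" and halt: "halted (state t0 i)"
    and first: "\<forall>s<t0. \<forall>w\<in>pverts G. \<not> halted (state s w)"
    and v: "v \<in> pverts G" and t: "t0 \<le> t"
  shows "solves C (state t v)"
proof -
  note facts = solution_at_first_halt[OF i halt first v]
  have opt: "obj (state s v) = J_opt X a g C" if "t0 \<le> s" for s
    using monoD[OF obj_mono[OF v], of "t0 - D" s] facts(3) that obj_le_J_opt[OF v, of s]
    by (intro antisym) auto
  have "active_set X a g C \<subseteq> cand (state t v)"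
    using t
  proof (induction rule: dec_induct)
    case base
    show ?case
      using active_at_first_halt[OF i halt first v] .
  next
    case (step s)
    show ?case
    proof (cases "halted (state s v)")
      case True
      then show ?thesis
        using state_halted[OF True] step.IH by simp
    next
      case False
      then show ?thesis
        using active_flow_step[OF v False, of v] opt[of "Suc s"] step facts(2) by auto
    qed
  qed
  then show ?thesis
    using opt[OF t] solves_if_optimal_value[OF v opt[OF t]] by (auto simp: solves_def)
qed

text \<open>
  If no node ever halts by its counter, every node turns infeasible; then so is \<open>C\<close>, whose value
  bounds all objectives from above.
\<close>

lemma converged_without_halt:
  assumes "\<And>t v. v \<in> pverts G \<Longrightarrow> \<not> halted (state t v)"
  shows "\<exists>T. \<forall>t\<ge>T. \<forall>v\<in>pverts G. solves C (state t v)"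
proof -
  have "\<exists>s. \<forall>v\<in>pverts G. obj (state (s v) v) = \<infinity>"
    using eventually_halted_or_infinite assms by (intro bchoice) blast
  then obtain s where s: "\<And>v. v \<in> pverts G \<Longrightarrow> obj (state (s v) v) = \<infinity>"
    by auto
  have "solves C (state t v)" if t: "Max (s ` pverts G) \<le> t" and v: "v \<in> pverts G" for t v
  proof -
    have "s v \<le> Max (s ` pverts G)"
      using v finite_nodes by (intro Max_ge) auto
    then have "s v \<le> t"
      using t by simp
    then have inf: "obj (state t v) = \<infinity>"
      using monoD[OF obj_mono[OF v], of "s v" t] s[OF v] by simp
    then have J: "obj (state t v) = J_opt X a g C"
      using obj_le_J_opt[OF v, of t] by simp
    then have "active_set X a g C = {}"
      using inf J_opt_eq_infinity_iff[of C] by (simp add: active_set_def)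
    then show ?thesis
      using J solves_if_optimal_value[OF v J] by (auto simp: solves_def)
  qed
  then show ?thesis by blast
qed

lemma acc_converges: "\<exists>T. \<forall>t\<ge>T. \<forall>v\<in>pverts G. solves C (state t v)"
proof (cases "\<exists>t. \<exists>v\<in>pverts G. halted (state t v)")
  case True
  let ?P = "\<lambda>t. \<exists>v\<in>pverts G. halted (state t v)"
  obtain i where "i \<in> pverts G" "halted (state (Least ?P) i)"
    using LeastI_ex[of ?P] True by blast
  moreover have "\<forall>s<Least ?P. \<forall>w\<in>pverts G. \<not> halted (state s w)"
    using not_less_Least[of _ ?P] by blast
  ultimately show ?thesis
    using converged_after_first_halt by blast
next
  case False
  then show ?thesis
    using converged_without_halt by blast
qed

end


section \<open>The consensus theorem\<close>

theorem proposition3: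
  fixes X :: "(real^'d) set" and a :: "real^'d"
    and \<Delta> :: "(real^'l) set" and f :: "real^'d \<Rightarrow> real^'l \<Rightarrow> real"
    and \<delta> :: "nat \<Rightarrow> real^'l" and N n :: nat
    and G :: "nat pair_pre_digraph" and Cl :: "nat \<Rightarrow> nat set"
    and C :: "nat set" and g :: "nat \<Rightarrow> real^'d \<Rightarrow> real"
    and node :: "nat \<Rightarrow> nat \<Rightarrow> (real^'d) acc_state"
  assumes X: "compact X" "convex X"
    and f_convex: "\<And>\<theta>. \<theta> \<in> \<Delta> \<Longrightarrow> convex_on UNIV (\<lambda>x. f x \<theta>)"
    and C_def: "C = {1..N}"
    and samples: "\<And>j. j \<in> C \<Longrightarrow> \<delta> j \<in> \<Delta>"
    and g_def: "g = sampled_constr f \<delta>"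
    and unique_min: "unique_minimum_condition X a g C"
    and G: "pair_wf_digraph G" "pverts G = {1..n}" "strongly_connected (with_proj G)"
    and Cl: "\<And>i. i \<in> {1..n} \<Longrightarrow> Cl i \<subseteq> C" "(\<Union>i\<in>{1..n}. Cl i) = C"
    and node_def: "node = acc X a g G Cl"
  shows "(\<forall>i\<in>{1..n}. mono (\<lambda>t. obj (node t i)))
       \<and> (\<exists>T. \<forall>t\<ge>T. \<forall>i\<in>{1..n}.
             obj (node t i) = J_opt X a g C \<and> sol (node t i) = x_opt X a g C
           \<and> cand (node t i) = active_set X a g C)
       \<and> (general_position X g C \<longrightarrow>
           (\<forall>t. \<forall>i\<in>{1..n}. finite (cand (node t i)) \<and> card (cand (node t i)) \<le> CARD('d)
              \<and> (\<forall>k\<in>out_neighbors G i.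
                   acc_message (node t) (i, k) = (obj (node t i), cand (node t i)))))"
proof -
  have "convex_program X a g C"
  proof
    show "convex_on X (g j)" if "j \<in> C" for j
      using f_convex[OF samples[OF that]] X(2) convex_on_subset
      by (auto simp: g_def sampled_constr_def[abs_def])
  qed (use X unique_min C_def in auto)
  then interpret acc_network X a g C G Cl
    using G Cl(2) by (intro acc_network.intro acc_network_axioms.intro) auto
  have node: "node = state"
    by (simp add: node_def)
  have mono: "\<forall>i\<in>{1..n}. mono (\<lambda>t. obj (node t i))"
    using obj_mono G(2) by (simp add: node)
  have conv: "\<exists>T. \<forall>t\<ge>T. \<forall>i\<in>{1..n}. obj (node t i) = J_opt X a g C
      \<and> sol (node t i) = x_opt X a g C \<and> cand (node t i) = active_set X a g C"
    using acc_converges G(2) by (simp add: node solves_def) blast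
  have "finite (cand (node t i)) \<and> card (cand (node t i)) \<le> CARD('d)"
    if gp: "general_position X g C" and i: "i \<in> {1..n}" for t i
  proof -
    have i': "i \<in> pverts G"
      using i G(2) by simp
    obtain L where "L \<subseteq> C" "solves L (node t i)"
      using state_solves[OF i'] node by blast
    then show ?thesis
      using card_active_set_le[OF gp] cand_subset[OF i', of t] finite_constrs finite_subset
      by (auto simp: solves_def node)
  qed
  with mono conv show ?thesis
    by (simp add: acc_message_def)
qed

end
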